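(* Suppose there exists a constant $\mu>0$ such that $\|A\|_{L_2(\Pi)}^2\ge \mu^{-2}\|A\|_2^2$ for all $A\in\mathbb{R}^{m_1\times m_2}$, and suppose $\mathbb{E}(\Delta^2)<\infty$. Let $\varrho\ge 1$ and let $\lambda>0$ be a regularization parameter satisfying $\sqrt\lambda\ge 2\varrho\mu\sqrt S$. Let $\hat A$ be the rank penalized estimator with parameter $\lambda$. Then (a) $$\mathbb{E}(\operatorname{rank}(\hat A))\le\max\left\{\left(1+\frac{2}{4\varrho^2-1}\right)\operatorname{rank}(A_0),\ \frac{1}{4\varrho^2}\right\};$$ (b) $$\mathbb{E}\left(\|\hat A-A_0\|_{L_2(\Pi)}\right)\le\inf_{A\in\mathbb{R}^{m_1\times m_2}}\left\{\|A-A_0\|_{L_2(\Pi)}+\frac52\sqrt{\lambda\max\left(\operatorname{rank}(A),\frac{\operatorname{rank}(A_0)}{\varrho^2},\frac{1}{4\varrho^2}\right)}\right\};$$ (c) $$\mathbb{E}\left(\|\hat A-A_0\|_{L_2(\Pi)}^2\right)\le\inf_{A\in\mathbb{R}^{m_1\times m_2}}\left\{\left(1+\frac{2}{2\varrho^2-1}\right)\|A-A_0\|_{L_2(\Pi)}^2+2\lambda\left(1+\frac{1}{2\varrho^2-1}\right)\max\left(\operatorname{rank}(A),\frac12\right)\right\}.$$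
   Context: Trace regression model: one observes $n$ independent random pairs $(X_i,Y_i)$, $i=1,\dots,n$, where $X_i$ is a random matrix in $\mathbb{R}^{m_1\times m_2}$ with known distribution $\Pi_i$ and $Y_i$ is a real random variable with $\mathbb{E}(Y_i\mid X_i)=\operatorname{tr}(X_i^TA_0)$, for an unknown fixed matrix $A_0\in\mathbb{R}^{m_1\times m_2}$. All expectations written in the definitions below are assumed to be finite. Notation: $\langle A,B\rangle=\operatorname{tr}(A^TB)$; $\|A\|_2$ is the Frobenius norm and $\|A\|_\infty=\sigma_1(A)$ is the largest singular value of $A$; $m_1\wedge m_2=\min(m_1,m_2)$. With $\Pi=\frac1n\sum_{i=1}^n\Pi_i$, set $$\langle A,B\rangle_{L_2(\Pi)}=\frac1n\sum_{i=1}^n\mathbb{E}\big(\langle A,X_i\rangle\langle B,X_i\rangle\big),\qquad \|A\|_{L_2(\Pi)}^2=\langle A,A\rangle_{L_2(\Pi)}.$$ Let $M=\frac1n\sum_{i=1}^n\big(Y_iX_i-\mathbb{E}(Y_iX_i)\big)$ and $\Delta=\|M\|_\infty$. For $r>0$ let $\mathcal{B}_r$ be the set of random variables $W$ (on the underlying probability space) with $0\le W\le r$, and set $$S=\sup_{W\in\mathcal{B}_{m_1\wedge m_2}}\frac{\mathbb{E}(\Delta^2W)}{\max\{\mathbb{E}(W),1\}}.$$ The rank penalized estimator with parameter $\lambda>0$ is $$\hat A\in\operatorname*{arg\,min}_{A\in\mathbb{R}^{m_1\times m_2}}\left\{\|A\|_{L_2(\Pi)}^2-\Big\langle\frac2n\sum_{i=1}^nY_iX_i,A\Big\rangle+\lambda\operatorname{rank}(A)\right\}.$$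 *)

theory Defs
  imports "HOL-Probability.Probability"
begin

section \<open>Matrices\<close>

text \<open>An \<open>m1 \<times> m2\<close> matrix is an element of \<^typ>\<open>real^'n^'m\<close> with \<open>m1 = CARD('m)\<close> rows and
  \<open>m2 = CARD('n)\<close> columns. The library norm of this type is the Frobenius norm; see
  \<open>norm_eq_sqrt_mat_inner\<close>.\<close>

definition mat_inner :: "real^'n^'m \<Rightarrow> real^'n^'m \<Rightarrow> real" where
  "mat_inner A B = trace (transpose A ** B)"

lemma mat_inner_eq_inner: "mat_inner A B = A \<bullet> B"
proof -
  have "mat_inner A B = (\<Sum>j\<in>UNIV. \<Sum>i\<in>UNIV. A $ i $ j * B $ i $ j)"
    by (simp add: mat_inner_def trace_def matrix_matrix_mult_def transpose_def)
  also have "\<dots> = (\<Sum>i\<in>UNIV. \<Sum>j\<in>UNIV. A $ i $ j * B $ i $ j)"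
    by (rule sum.swap)
  finally show ?thesis
    by (simp add: inner_vec_def)
qed

lemma norm_eq_sqrt_mat_inner: "norm A = sqrt (mat_inner A A)" for A :: "real^'n^'m"
  by (simp add: mat_inner_eq_inner norm_eq_sqrt_inner)

text \<open>The singular values are the square roots of the eigenvalues of \<open>A\<^sup>T A\<close>. When \<open>m2 > m1\<close> this
  set always contains \<open>0\<close>, which is not always one of the \<open>min m1 m2\<close> singular values in the usual
  count; the largest element is not affected.\<close>

definition singular_values :: "real^'n^'m \<Rightarrow> real set" where
  "singular_values A =
     {\<sigma>. 0 \<le> \<sigma> \<and> (\<exists>v. v \<noteq> 0 \<and> (transpose A ** A) *v v = \<sigma>\<^sup>2 *\<^sub>R v)}"

definition largest_singular_value :: "real^'n^'m \<Rightarrow> real" where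
  "largest_singular_value A = Max (singular_values A)"

lemma inner_gram: "((transpose A ** A) *v v) \<bullet> w = (A *v v) \<bullet> (A *v w)"
  for A :: "real^'n^'m"
  by (metis dot_lmul_matrix matrix_vector_mul_assoc transpose_matrix_vector)

lemma finite_singular_values: "finite (singular_values A)"
proof -
  let ?G = "transpose A ** A"
  define f where "f \<sigma> = (SOME v. v \<noteq> 0 \<and> ?G *v v = \<sigma>\<^sup>2 *\<^sub>R v)" for \<sigma> :: real
  have f: "f \<sigma> \<noteq> 0 \<and> ?G *v f \<sigma> = \<sigma>\<^sup>2 *\<^sub>R f \<sigma>" if "\<sigma> \<in> singular_values A" for \<sigma>
  proof -
    have "\<exists>v. v \<noteq> 0 \<and> ?G *v v = \<sigma>\<^sup>2 *\<^sub>R v"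
      using that by (simp add: singular_values_def)
    then show ?thesis unfolding f_def by (rule someI_ex)
  qed
  have orth: "f \<sigma> \<bullet> f \<tau> = 0"
    if "\<sigma> \<in> singular_values A" "\<tau> \<in> singular_values A" "\<sigma> \<noteq> \<tau>" for \<sigma> \<tau>
  proof -
    have "\<sigma>\<^sup>2 * (f \<sigma> \<bullet> f \<tau>) = (?G *v f \<sigma>) \<bullet> f \<tau>"
      using f[OF that(1)] by simp
    also have "\<dots> = (?G *v f \<tau>) \<bullet> f \<sigma>"
      unfolding inner_gram by (rule inner_commute)
    also have "\<dots> = \<tau>\<^sup>2 * (f \<sigma> \<bullet> f \<tau>)"
      using f[OF that(2)] by (simp add: inner_commute)
    finally have "\<sigma>\<^sup>2 * (f \<sigma> \<bullet> f \<tau>) = \<tau>\<^sup>2 * (f \<sigma> \<bullet> f \<tau>)" .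
    moreover have "\<sigma>\<^sup>2 \<noteq> \<tau>\<^sup>2"
      using that by (auto simp: singular_values_def)
    ultimately show ?thesis by simp
  qed
  have inj: "inj_on f (singular_values A)"
    by (rule inj_onI) (metis f orth inner_eq_zero_iff)
  have "pairwise orthogonal (f ` singular_values A)"
    unfolding pairwise_def orthogonal_def using orth by blast
  moreover have "0 \<notin> f ` singular_values A" using f by force
  ultimately have "independent (f ` singular_values A)"
    by (rule pairwise_orthogonal_independent)
  then have "finite (f ` singular_values A)"
    by (rule finiteI_independent)
  then show ?thesis using inj by (rule finite_imageD)
qed

lemma onorm_in_singular_values: "onorm ((*v) A) \<in> singular_values A"
  for A :: "real^'n^'m"
proof -
  let ?k = "onorm ((*v) A)" and ?G = "transpose A ** A"
  have bl: "bounded_linear ((*v) A)"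
    by (rule matrix_vector_mul_bounded_linear)
  have k0: "0 \<le> ?k" using bl by (rule onorm_pos_le)
  have "continuous_on (sphere 0 1) (\<lambda>v. norm (A *v v))"
    by (intro continuous_intros linear_continuous_on bl)
  moreover have "sphere (0 :: real^'n) 1 \<noteq> {}" by simp
  ultimately obtain v where v: "v \<in> sphere 0 1"
      and max: "\<And>w. w \<in> sphere 0 1 \<Longrightarrow> norm (A *v w) \<le> norm (A *v v)"
    using continuous_attains_sup[OF compact_sphere] by blast
  have nv: "norm v = 1" using v by simp
  have "norm (A *v w) \<le> norm (A *v v) * norm w" for w
  proof (cases "w = 0")
    case False
    have "norm (A *v ((1 / norm w) *\<^sub>R w)) \<le> norm (A *v v)"
      using False by (intro max) simp
    then show ?thesis
      using False by (simp add: matrix_vector_mult_scaleR divide_simps)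
  qed simp
  then have "?k \<le> norm (A *v v)" by (rule onorm_le)
  moreover have "norm (A *v v) \<le> ?k" using onorm[OF bl, of v] nv by simp
  ultimately have k: "norm (A *v v) = ?k" by simp
  have "(norm (?G *v v))\<^sup>2 = (A *v v) \<bullet> (A *v (?G *v v))"
    by (simp add: power2_norm_eq_inner inner_gram)
  also have "\<dots> \<le> norm (A *v v) * norm (A *v (?G *v v))"
    by (rule norm_cauchy_schwarz)
  also have "\<dots> \<le> ?k * (?k * norm (?G *v v))"
    unfolding k using onorm[OF bl] k0 by (rule mult_left_mono)
  finally have "norm (?G *v v) * norm (?G *v v) \<le> ?k\<^sup>2 * norm (?G *v v)"
    by (simp add: power2_eq_square mult.assoc)
  then have G: "norm (?G *v v) \<le> ?k\<^sup>2"
    by (cases "norm (?G *v v) = 0") (auto simp: mult_le_cancel_right)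
  have Gv: "(?G *v v) \<bullet> v = ?k\<^sup>2"
    by (simp add: inner_gram k flip: power2_norm_eq_inner)
  have "(norm (?G *v v - ?k\<^sup>2 *\<^sub>R v))\<^sup>2 = (norm (?G *v v))\<^sup>2 - (?k\<^sup>2)\<^sup>2"
    using Gv nv unfolding power2_norm_eq_inner
    by (simp add: inner_diff_left inner_diff_right inner_commute power2_eq_square norm_eq_1)
  also have "\<dots> \<le> 0" using power_mono[OF G, of 2] by simp
  finally have "?G *v v = ?k\<^sup>2 *\<^sub>R v" by simp
  moreover have "v \<noteq> 0" using nv by auto
  ultimately show ?thesis using k0 unfolding singular_values_def by blast
qed

lemma largest_singular_value_eq_onorm: "largest_singular_value A = onorm ((*v) A)"
  for A :: "real^'n^'m"
  unfolding largest_singular_value_def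
proof (rule Max_eqI[OF finite_singular_values _ onorm_in_singular_values])
  fix \<sigma> assume "\<sigma> \<in> singular_values A"
  then obtain v where s0: "0 \<le> \<sigma>" and v0: "v \<noteq> 0"
      and v: "(transpose A ** A) *v v = \<sigma>\<^sup>2 *\<^sub>R v"
    unfolding singular_values_def by blast
  have "(norm (A *v v))\<^sup>2 = (\<sigma> * norm v)\<^sup>2"
    by (simp add: power2_norm_eq_inner power_mult_distrib v flip: inner_gram)
  then have "norm (A *v v) = \<sigma> * norm v"
    using s0 by (simp add: power2_eq_iff_nonneg)
  moreover have "norm (A *v v) \<le> onorm ((*v) A) * norm v"
    by (rule onorm[OF matrix_vector_mul_bounded_linear])
  ultimately show "\<sigma> \<le> onorm ((*v) A)" using v0 by simp
qed

section \<open>Trace regression\<close>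

text \<open>Throughout, \<open>P\<close> is the probability on the underlying space and the sample is indexed by
  \<open>{1..n}\<close>. Expectations with respect to the law of \<open>X i\<close> are written as integrals over \<open>P\<close>.\<close>

definition L2_inner ::
  "'a measure \<Rightarrow> nat \<Rightarrow> (nat \<Rightarrow> 'a \<Rightarrow> real^'n^'m) \<Rightarrow> real^'n^'m \<Rightarrow> real^'n^'m \<Rightarrow> real" where
  "L2_inner P n X A B =
     (1 / real n) * (\<Sum>i=1..n. \<integral>\<omega>. mat_inner A (X i \<omega>) * mat_inner B (X i \<omega>) \<partial>P)"

definition L2_norm ::
  "'a measure \<Rightarrow> nat \<Rightarrow> (nat \<Rightarrow> 'a \<Rightarrow> real^'n^'m) \<Rightarrow> real^'n^'m \<Rightarrow> real" where
  "L2_norm P n X A = sqrt (L2_inner P n X A A)"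

definition noise_matrix ::
  "'a measure \<Rightarrow> nat \<Rightarrow> (nat \<Rightarrow> 'a \<Rightarrow> real^'n^'m) \<Rightarrow> (nat \<Rightarrow> 'a \<Rightarrow> real) \<Rightarrow> 'a \<Rightarrow> real^'n^'m" where
  "noise_matrix P n X Y \<omega> =
     (1 / real n) *\<^sub>R (\<Sum>i=1..n. Y i \<omega> *\<^sub>R X i \<omega> - (\<integral>\<omega>'. Y i \<omega>' *\<^sub>R X i \<omega>' \<partial>P))"

definition noise_level ::
  "'a measure \<Rightarrow> nat \<Rightarrow> (nat \<Rightarrow> 'a \<Rightarrow> real^'n^'m) \<Rightarrow> (nat \<Rightarrow> 'a \<Rightarrow> real) \<Rightarrow> 'a \<Rightarrow> real" where
  "noise_level P n X Y \<omega> = largest_singular_value (noise_matrix P n X Y \<omega>)"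

definition bounded_rvs :: "'a measure \<Rightarrow> real \<Rightarrow> ('a \<Rightarrow> real) set" where
  "bounded_rvs P r = {W \<in> borel_measurable P. \<forall>\<omega>\<in>space P. 0 \<le> W \<omega> \<and> W \<omega> \<le> r}"

text \<open>If the square of the noise level is integrable, the following set of real numbers is
  nonempty and bounded above, so that its supremum is a genuine one.\<close>

definition noise_sup ::
  "'a measure \<Rightarrow> nat \<Rightarrow> (nat \<Rightarrow> 'a \<Rightarrow> real^'n^'m) \<Rightarrow> (nat \<Rightarrow> 'a \<Rightarrow> real) \<Rightarrow> real" where
  "noise_sup P n (X :: nat \<Rightarrow> 'a \<Rightarrow> real^'n^'m) Y =
     (SUP W \<in> bounded_rvs P (real (min CARD('m) CARD('n))).
        (\<integral>\<omega>. (noise_level P n X Y \<omega>)\<^sup>2 * W \<omega> \<partial>P) / max (\<integral>\<omega>. W \<omega> \<partial>P) 1)"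

definition rank_penalized_objective ::
  "'a measure \<Rightarrow> nat \<Rightarrow> (nat \<Rightarrow> 'a \<Rightarrow> real^'n^'m) \<Rightarrow> (nat \<Rightarrow> 'a \<Rightarrow> real) \<Rightarrow> real \<Rightarrow> 'a
    \<Rightarrow> real^'n^'m \<Rightarrow> real" where
  "rank_penalized_objective P n X Y lam \<omega> A =
     (L2_norm P n X A)\<^sup>2
     - mat_inner ((2 / real n) *\<^sub>R (\<Sum>i=1..n. Y i \<omega> *\<^sub>R X i \<omega>)) A
     + lam * real (rank A)"

text \<open>As an estimator, the minimizer is a measurable function of the outcome \<open>\<omega>\<close>.\<close>

definition rank_penalized_estimator ::
  "'a measure \<Rightarrow> nat \<Rightarrow> (nat \<Rightarrow> 'a \<Rightarrow> real^'n^'m) \<Rightarrow> (nat \<Rightarrow> 'a \<Rightarrow> real) \<Rightarrow> real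
    \<Rightarrow> ('a \<Rightarrow> real^'n^'m) \<Rightarrow> bool" where
  "rank_penalized_estimator P n X Y lam Ahat \<longleftrightarrow>
     Ahat \<in> borel_measurable P \<and>
     (\<forall>\<omega>\<in>space P. is_arg_min (rank_penalized_objective P n X Y lam \<omega>) (\<lambda>_. True) (Ahat \<omega>))"

end

theory Submission
  imports Defs
begin

text \<open>The regression model enters once, through the identity \<open>E (Y\<^sub>i \<langle>X\<^sub>i, A\<rangle>) = E (\<langle>X\<^sub>i, A0\<rangle> \<langle>X\<^sub>i, A\<rangle>)\<close>. It
  turns the objective into \<open>\<parallel>A - A0\<parallel>\<^sup>2 - 2 \<langle>M, A\<rangle> + lam * rank A\<close> plus a constant, with the
  \<open>L\<^sub>2(\<Pi>)\<close> norm and the centred noise matrix \<open>M\<close>. Comparing the minimizer with any \<open>A\<close> leaves the noise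
  term \<open>2 \<langle>M, Ahat - A\<rangle>\<close>. Trace duality bounds \<open>\<langle>M, B\<rangle>\<close> by the largest singular value \<open>\<Delta>\<close> of \<open>M\<close> times
  \<open>sqrt (rank B)\<close> times the Frobenius norm of \<open>B\<close> (\<open>inner_le_onorm_sqrt_rank\<close>), and the Frobenius norm is
  at most \<open>\<mu>\<close> times the \<open>L\<^sub>2(\<Pi>)\<close> norm. With \<open>a = \<mu> * \<Delta> * sqrt W\<close>, where \<open>W\<close> is
  \<open>rank Ahat + rank A\<close> capped at \<open>min m1 m2\<close>, this gives pointwise (\<open>basic_inequality\<close>)

  \<open>\<parallel>Ahat - A0\<parallel>\<^sup>2 + lam * rank Ahat
     \<le> \<parallel>A - A0\<parallel>\<^sup>2 + 2 * a * (\<parallel>Ahat - A0\<parallel> + \<parallel>A - A0\<parallel>) + lam * rank A\<close>.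

  The quantity \<open>S\<close> bounds \<open>E (\<Delta>\<^sup>2 W)\<close> by \<open>S * max (E W) 1\<close>, even though \<open>W\<close> depends on the same data as
  \<open>\<Delta>\<close>; the size of \<open>lam\<close> then gives \<open>4 * \<rho>\<^sup>2 * E (a\<^sup>2) \<le> lam * max (E (rank Ahat) + rank A) 1\<close>
  (\<open>expectation_scaled_noise_power2\<close>).

  These two inequalities imply the three claims. For the rank, take \<open>A = A0\<close> and absorb the error by
  Young's inequality. For the squared error, Young's inequality with weight \<open>1 / (2 * \<rho>\<^sup>2)\<close> makes the
  random rank cancel against the penalty. For the error itself, Cauchy--Schwarz in place of Young's
  inequality gives a quadratic inequality for the root mean square error, whose solution is estimated
  by means of the rank bound (\<open>oracle_constant_le\<close>). This last argument yields the constant \<open>2\<close> in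
  place of \<open>5 / 2\<close>.\<close>

section \<open>Cauchy--Schwarz inequalities and trace duality\<close>

text \<open>Both forms of the Cauchy--Schwarz inequality used here, for random variables and for the
  semidefinite form \<open>L2_inner\<close> on matrices, come from this fact about quadratic forms in two
  variables.\<close>
lemma discriminant_le:
  fixes a b c :: real
  assumes "\<And>s t. 0 \<le> s\<^sup>2 * a + 2 * s * t * b + t\<^sup>2 * c"
  shows "b\<^sup>2 \<le> a * c"
proof (cases "c = 0")
  case True
  have "0 \<le> a" using assms[of 1 0] by simp
  have "b = 0"
  proof (rule ccontr)
    assume "b \<noteq> 0"
    with assms[of 1 "- (a + 1) / (2 * b)"] True show False
      by (simp add: field_simps)
  qed
  with True show ?thesis by simp
next
  case False
  have "0 \<le> c" using assms[of 0 1] by simp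
  with False have "0 < c" by simp
  \<comment> \<open>With \<open>s = c\<close> the form is minimal at \<open>t = - b\<close>.\<close>
  have "0 \<le> c * (a * c - b\<^sup>2)"
    using assms[of c "- b"] by (simp add: algebra_simps power2_eq_square)
  with \<open>0 < c\<close> show ?thesis by (simp add: zero_le_mult_iff)
qed

lemma integral_Cauchy_Schwarz:
  fixes f g :: "'a \<Rightarrow> real"
  assumes [measurable]: "f \<in> borel_measurable M" "g \<in> borel_measurable M"
    and f: "integrable M (\<lambda>x. (f x)\<^sup>2)" and g: "integrable M (\<lambda>x. (g x)\<^sup>2)"
  shows "integrable M (\<lambda>x. f x * g x)"
    and "(\<integral>x. f x * g x \<partial>M)\<^sup>2 \<le> (\<integral>x. (f x)\<^sup>2 \<partial>M) * (\<integral>x. (g x)\<^sup>2 \<partial>M)"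
proof -
  show fg: "integrable M (\<lambda>x. f x * g x)"
  proof (rule Bochner_Integration.integrable_bound)
    show "integrable M (\<lambda>x. (f x)\<^sup>2 + (g x)\<^sup>2)" using f g by simp
    show "AE x in M. norm (f x * g x) \<le> norm ((f x)\<^sup>2 + (g x)\<^sup>2)"
    proof (rule AE_I2)
      fix x
      have "2 * (\<bar>f x\<bar> * \<bar>g x\<bar>) \<le> (f x)\<^sup>2 + (g x)\<^sup>2"
        using sum_squares_bound[of "\<bar>f x\<bar>" "\<bar>g x\<bar>"] by (simp add: mult.assoc)
      moreover have "0 \<le> \<bar>f x\<bar> * \<bar>g x\<bar>" by simp
      ultimately have "\<bar>f x\<bar> * \<bar>g x\<bar> \<le> (f x)\<^sup>2 + (g x)\<^sup>2" by linarith
      then show "norm (f x * g x) \<le> norm ((f x)\<^sup>2 + (g x)\<^sup>2)"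
        by (simp add: abs_mult)
    qed
  qed simp
  show "(\<integral>x. f x * g x \<partial>M)\<^sup>2 \<le> (\<integral>x. (f x)\<^sup>2 \<partial>M) * (\<integral>x. (g x)\<^sup>2 \<partial>M)"
  proof (rule discriminant_le)
    fix s t :: real
    have "0 \<le> (\<integral>x. (s * f x + t * g x)\<^sup>2 \<partial>M)" by simp
    also have "\<dots> = (\<integral>x. s\<^sup>2 * (f x)\<^sup>2 + 2 * s * t * (f x * g x) + t\<^sup>2 * (g x)\<^sup>2 \<partial>M)"
      by (simp add: power2_sum power_mult_distrib algebra_simps)
    also have "\<dots> = s\<^sup>2 * (\<integral>x. (f x)\<^sup>2 \<partial>M) + 2 * s * t * (\<integral>x. f x * g x \<partial>M)
        + t\<^sup>2 * (\<integral>x. (g x)\<^sup>2 \<partial>M)"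
      using f g fg by simp
    finally show "0 \<le> \<dots>" .
  qed
qed

lemma norm_matrix_vector_le: "norm (A *v v) \<le> norm A * norm v" for A :: "real^'n^'m"
proof -
  have "norm (A *v v) = L2_set (\<lambda>i. norm ((A *v v) $ i)) UNIV"
    by (simp add: norm_vec_def)
  also have "\<dots> \<le> L2_set (\<lambda>i. norm (A $ i) * norm v) UNIV"
    by (rule L2_set_mono) (simp_all add: matrix_mult_dot Cauchy_Schwarz_ineq2)
  also have "\<dots> = norm A * norm v"
    by (simp add: norm_vec_def L2_set_left_distrib)
  finally show ?thesis .
qed

text \<open>The trace of \<open>A\<^sup>T B\<close> may be computed in any orthonormal system that spans the rows of \<open>B\<close>, since
  \<open>B\<close> vanishes on the orthogonal complement of its row space.\<close>
lemma inner_eq_sum_orthonormal_rows: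
  fixes A B :: "real^'n^'m"
  assumes "pairwise orthogonal E" "\<And>e. e \<in> E \<Longrightarrow> norm e = 1" "finite E" "rows B \<subseteq> span E"
  shows "A \<bullet> B = (\<Sum>e\<in>E. (A *v e) \<bullet> (B *v e))"
proof -
  have "A $ i \<bullet> B $ i = (\<Sum>e\<in>E. (A *v e) $ i * (B *v e) $ i)" for i
  proof -
    have "B $ i \<in> rows B"
      by (auto simp: rows_def row_def)
    then have "B $ i = (\<Sum>e\<in>E. (B $ i \<bullet> e) *\<^sub>R e)"
      using assms by (intro orthonormal_basis_expand[symmetric]) auto
    then have "A $ i \<bullet> B $ i = A $ i \<bullet> (\<Sum>e\<in>E. (B $ i \<bullet> e) *\<^sub>R e)"
      by simp
    also have "\<dots> = (\<Sum>e\<in>E. (A *v e) $ i * (B *v e) $ i)"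
      by (simp add: inner_sum_right matrix_mult_dot mult.commute)
    finally show ?thesis .
  qed
  then have "A \<bullet> B = (\<Sum>i\<in>UNIV. \<Sum>e\<in>E. (A *v e) $ i * (B *v e) $ i)"
    by (simp add: inner_vec_def[of A])
  also have "\<dots> = (\<Sum>e\<in>E. (A *v e) \<bullet> (B *v e))"
    by (subst sum.swap) (simp add: inner_vec_def)
  finally show ?thesis .
qed

text \<open>Trace duality together with the bound of the nuclear norm by \<open>sqrt (rank B)\<close> times the Frobenius
  norm. In the trace formula above, for an orthonormal basis of the row space, only \<open>rank B\<close> terms
  occur, each is at most \<open>onorm A * norm (B *v e)\<close>, and Cauchy--Schwarz turns the sum of the
  \<open>norm (B *v e)\<close> into the Frobenius norm.\<close>
lemma inner_le_onorm_sqrt_rank: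
  fixes A B :: "real^'n^'m"
  shows "A \<bullet> B \<le> onorm ((*v) A) * sqrt (rank B) * norm B"
proof -
  obtain E where E: "pairwise orthogonal E" "\<And>e. e \<in> E \<Longrightarrow> norm e = 1" "independent E"
      "card E = dim (span (rows B))" "span E = span (rows B)"
    by (rule orthonormal_basis_subspace[OF subspace_span[of "rows B"]]) blast
  have fin: "finite E" using E(3) by (rule finiteI_independent)
  have rows: "rows B \<subseteq> span E" using E(5) by (simp add: span_superset)
  have card: "card E = rank B" using E(4) by (simp add: row_rank_def)
  let ?k = "onorm ((*v) A)"
  have bl: "bounded_linear ((*v) A)" by (rule matrix_vector_mul_bounded_linear)
  have "A \<bullet> B = (\<Sum>e\<in>E. (A *v e) \<bullet> (B *v e))"
    using E(1,2) fin rows by (rule inner_eq_sum_orthonormal_rows)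
  also have "\<dots> \<le> (\<Sum>e\<in>E. ?k * norm (B *v e))"
  proof (rule sum_mono)
    fix e assume "e \<in> E"
    have "(A *v e) \<bullet> (B *v e) \<le> norm (A *v e) * norm (B *v e)"
      by (rule norm_cauchy_schwarz)
    also have "norm (A *v e) \<le> ?k"
      using onorm[OF bl, of e] E(2)[OF \<open>e \<in> E\<close>] by simp
    finally show "(A *v e) \<bullet> (B *v e) \<le> ?k * norm (B *v e)"
      by (simp add: mult_right_mono)
  qed
  also have "\<dots> = ?k * (\<Sum>e\<in>E. \<bar>1\<bar> * \<bar>norm (B *v e)\<bar>)"
    by (simp add: sum_distrib_left)
  also have "\<dots> \<le> ?k * (L2_set (\<lambda>_. 1) E * L2_set (\<lambda>e. norm (B *v e)) E)"
    using bl by (intro mult_left_mono L2_set_mult_ineq onorm_pos_le)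
  also have "L2_set (\<lambda>e. norm (B *v e)) E = norm B"
    using inner_eq_sum_orthonormal_rows[OF E(1,2) fin rows, of B]
    by (simp add: L2_set_def norm_eq_sqrt_inner[of B] power2_norm_eq_inner)
  finally show ?thesis
    by (simp add: L2_set_def card mult.assoc)
qed

section \<open>The rank function\<close>

lemma rank_diff_le: "rank (A - B) \<le> rank A + rank B" for A B :: "real^'n^'m"
proof -
  have "rank (A - B) \<le> dim {x + y |x y. x \<in> range ((*v) A) \<and> y \<in> range ((*v) B)}"
    unfolding rank_dim_range
  proof (rule dim_subset, clarify)
    fix v
    have "(A - B) *v v = A *v v + B *v (- v)"
      by (simp add: matrix_vector_mult_diff_rdistrib vec.neg)
    then show "\<exists>x y. (A - B) *v v = x + y \<and> x \<in> range ((*v) A) \<and> y \<in> range ((*v) B)"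
      by blast
  qed
  also have "\<dots> \<le> rank A + rank B"
    using dim_sums_Int[of "range ((*v) A)" "range ((*v) B)"]
    by (simp add: rank_dim_range subspace_UNIV linear_subspace_image)
  finally show ?thesis .
qed

text \<open>The rank is lower semicontinuous: \<open>A\<close> is bounded below by some \<open>e > 0\<close> on its row space, so a
  matrix at distance less than \<open>e\<close> is still injective there. Borel measurability of the rank, hence
  the meaning of \<open>E (rank Z)\<close> for a random matrix \<open>Z\<close>, rests on this.\<close>
lemma open_rank_ge: "open {A :: real^'n^'m. k \<le> rank A}"
proof (rule openI)
  fix A :: "real^'n^'m"
  assume "A \<in> {A. k \<le> rank A}"
  then have k: "k \<le> rank A" by simp
  let ?V = "span (rows A)"
  obtain e where e: "e > 0" "\<And>v. v \<in> ?V \<Longrightarrow> e * norm v \<le> norm (A *v v)"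
    using injective_imp_isometric[of ?V "(*v) A"] nullspace_inter_rowspace[of A]
    by (auto simp: closed_subspace matrix_vector_mul_bounded_linear)
  have "k \<le> rank B" if "dist A B < e" for B
  proof -
    have zero: "v = 0" if "v \<in> ?V" "B *v v = 0" for v
    proof (rule ccontr)
      assume "v \<noteq> 0"
      have "e * norm v \<le> norm ((A - B) *v v)"
        using e(2) that by (simp add: matrix_vector_mult_diff_rdistrib)
      also have "\<dots> \<le> norm (A - B) * norm v" by (rule norm_matrix_vector_le)
      also have "\<dots> < e * norm v"
        using \<open>dist A B < e\<close> \<open>v \<noteq> 0\<close> by (simp add: dist_norm)
      finally show False by simp
    qed
    have "inj_on ((*v) B) ?V"
      by (simp add: linear_injective_on_subspace_0 zero)
    then have "dim ((*v) B ` ?V) = dim ?V"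
      by (intro dim_image_eq) (simp_all add: span_span del: dim_span)
    then have "rank A \<le> rank B"
      unfolding rank_dim_range[of B] row_rank_def[of A]
      by (metis dim_span dim_subset image_mono subset_UNIV)
    with k show ?thesis by simp
  qed
  with \<open>e > 0\<close> show "\<exists>e>0. ball A e \<subseteq> {A. k \<le> rank A}"
    by (intro exI[of _ e]) auto
qed

lemma borel_measurable_rank:
  "(\<lambda>A :: real^'n^'m. real (rank A)) \<in> borel_measurable borel"
proof (rule borel_measurableI_ge)
  fix a :: real
  have eq: "{A \<in> space borel. a \<le> real (rank (A :: real^'n^'m))} = {A. nat \<lceil>a\<rceil> \<le> rank A}"
    by (auto simp: nat_le_iff ceiling_le_iff)
  show "{A \<in> space borel. a \<le> real (rank (A :: real^'n^'m))} \<in> sets borel"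
    unfolding eq by (rule borel_open[OF open_rank_ge])
qed

section \<open>The population norm and the penalized objective\<close>

locale trace_regression = prob_space P for P :: "'a measure" +
  fixes n :: nat and X :: "nat \<Rightarrow> 'a \<Rightarrow> real^'n^'m" and Y :: "nat \<Rightarrow> 'a \<Rightarrow> real"
    and A0 :: "real^'n^'m"
  assumes X_measurable: "\<And>i. i \<in> {1..n} \<Longrightarrow> X i \<in> borel_measurable P"
    and Y_measurable: "\<And>i. i \<in> {1..n} \<Longrightarrow> Y i \<in> borel_measurable P"
    and YX_integrable: "\<And>i. i \<in> {1..n} \<Longrightarrow> integrable P (\<lambda>\<omega>. Y i \<omega> *\<^sub>R X i \<omega>)"
    and XX_integrable: "\<And>i A B. i \<in> {1..n} \<Longrightarrow>
          integrable P (\<lambda>\<omega>. mat_inner A (X i \<omega>) * mat_inner B (X i \<omega>))"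
    and model: "\<And>i. i \<in> {1..n} \<Longrightarrow>
          AE \<omega> in P. real_cond_exp P (vimage_algebra (space P) (X i) borel) (Y i) \<omega>
                     = trace (transpose (X i \<omega>) ** A0)"
begin

abbreviation "ip \<equiv> L2_inner P n X"
abbreviation "nrm \<equiv> L2_norm P n X"

lemma L2_inner_commute: "ip A B = ip B A"
  by (simp add: L2_inner_def mult.commute)

lemma bilinear_L2_inner: "bilinear ip"
proof -
  have add: "ip (A + B) C = ip A C + ip B C" for A B C
    using XX_integrable
    by (simp add: L2_inner_def mat_inner_eq_inner inner_add_left ring_distribs sum.distrib)
  have scale: "ip (c *\<^sub>R A) C = c * ip A C" for c A C
    by (simp add: L2_inner_def mat_inner_eq_inner mult.assoc sum_distrib_left mult.left_commute)
  have "linear (\<lambda>A. ip A C)" for C by (rule linearI) (simp_all add: add scale)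
  moreover from this have "linear (\<lambda>B. ip C B)" for C by (simp add: L2_inner_commute[of C])
  ultimately show ?thesis by (simp add: bilinear_def)
qed

lemma L2_inner_nonneg: "0 \<le> ip A A"
  by (simp add: L2_inner_def sum_nonneg)

lemma L2_norm_nonneg: "0 \<le> nrm A"
  by (simp add: L2_norm_def L2_inner_nonneg)

lemma L2_norm_power2: "(nrm A)\<^sup>2 = ip A A"
  by (simp add: L2_norm_def L2_inner_nonneg)

lemmas L2_inner_simps =
  bilinear_ladd[OF bilinear_L2_inner] bilinear_radd[OF bilinear_L2_inner]
  bilinear_lsub[OF bilinear_L2_inner] bilinear_rsub[OF bilinear_L2_inner]
  bilinear_lmul[OF bilinear_L2_inner] bilinear_rmul[OF bilinear_L2_inner]

lemma L2_inner_le_L2_norm: "\<bar>ip A B\<bar> \<le> nrm A * nrm B"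
proof -
  have "(ip A B)\<^sup>2 \<le> ip A A * ip B B"
  proof (rule discriminant_le)
    fix s t :: real
    show "0 \<le> s\<^sup>2 * ip A A + 2 * s * t * ip A B + t\<^sup>2 * ip B B"
      using L2_inner_nonneg[of "s *\<^sub>R A + t *\<^sub>R B"]
      by (simp add: L2_inner_simps L2_inner_commute[of B A] power2_eq_square algebra_simps)
  qed
  then have "\<bar>ip A B\<bar>\<^sup>2 \<le> (nrm A * nrm B)\<^sup>2"
    by (simp add: L2_norm_power2 power_mult_distrib)
  then show ?thesis
    by (rule power2_le_imp_le) (simp add: L2_norm_nonneg)
qed

lemma L2_norm_triangle_sub: "nrm (A - B) \<le> nrm A + nrm B"
proof (rule power2_le_imp_le)
  have "(nrm (A - B))\<^sup>2 = (nrm A)\<^sup>2 - 2 * ip A B + (nrm B)\<^sup>2"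
    by (simp add: L2_norm_power2 L2_inner_simps L2_inner_commute[of B A])
  also have "\<dots> \<le> (nrm A + nrm B)\<^sup>2"
    using L2_inner_le_L2_norm[of A B] by (simp add: power2_sum)
  finally show "(nrm (A - B))\<^sup>2 \<le> (nrm A + nrm B)\<^sup>2" .
qed (simp add: L2_norm_nonneg)

lemma borel_measurable_L2_norm: "nrm \<in> borel_measurable borel"
proof (rule borel_measurable_continuous_onI)
  have "bounded_bilinear ip"
    using bilinear_L2_inner by (simp add: bilinear_conv_bounded_bilinear)
  then have "continuous_on UNIV (\<lambda>A. ip A A)"
    by (rule bounded_bilinear.continuous_on) (rule continuous_on_id)+
  then show "continuous_on UNIV nrm"
    unfolding L2_norm_def[abs_def] by (rule continuous_on_real_sqrt)
qed

text \<open>The only use of the regression model: conditioning on \<open>X\<^sub>i\<close> replaces \<open>Y\<^sub>i\<close> by its linear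
  predictor, so that the averaged mean of \<open>Y\<^sub>i X\<^sub>i\<close> represents the functional \<open>A \<mapsto> ip A0 A\<close>.\<close>
lemma expectation_response:
  assumes i: "i \<in> {1..n}"
  shows "(\<integral>\<omega>. Y i \<omega> *\<^sub>R X i \<omega> \<partial>P) \<bullet> A = (\<integral>\<omega>. mat_inner A0 (X i \<omega>) * mat_inner A (X i \<omega>) \<partial>P)"
proof -
  let ?F = "vimage_algebra (space P) (X i) borel"
  have Xm: "X i \<in> borel_measurable P" and Ym: "Y i \<in> borel_measurable P"
    by (rule X_measurable[OF i], rule Y_measurable[OF i])
  have "subalgebra P ?F"
    using Xm unfolding subalgebra_def measurable_iff_sets by simp
  then interpret F: finite_measure_subalgebra P ?F
    by unfold_locales
  have [measurable]: "X i \<in> borel_measurable ?F"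
    by (rule measurable_vimage_algebra1) simp
  have fF: "(\<lambda>\<omega>. X i \<omega> \<bullet> A) \<in> borel_measurable ?F" by measurable
  have int: "integrable P (\<lambda>\<omega>. (X i \<omega> \<bullet> A) * Y i \<omega>)"
    using integrable_inner_left[OF YX_integrable[OF i], of A] by (simp add: mult.commute)
  have "(\<integral>\<omega>. Y i \<omega> *\<^sub>R X i \<omega> \<partial>P) \<bullet> A = (\<integral>\<omega>. (X i \<omega> \<bullet> A) * Y i \<omega> \<partial>P)"
    by (subst integral_inner_left[symmetric]) (simp_all add: YX_integrable[OF i] mult.commute)
  also have "\<dots> = (\<integral>\<omega>. (X i \<omega> \<bullet> A) * real_cond_exp P ?F (Y i) \<omega> \<partial>P)"
    using F.real_cond_exp_intg(2)[OF int fF Ym] by simp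
  also have "\<dots> = (\<integral>\<omega>. mat_inner A0 (X i \<omega>) * mat_inner A (X i \<omega>) \<partial>P)"
  proof (rule integral_cong_AE)
    show "AE \<omega> in P. (X i \<omega> \<bullet> A) * real_cond_exp P ?F (Y i) \<omega>
        = mat_inner A0 (X i \<omega>) * mat_inner A (X i \<omega>)"
      using model[OF i]
      by eventually_elim (simp add: mat_inner_eq_inner inner_commute flip: mat_inner_def)
    show "(\<lambda>\<omega>. (X i \<omega> \<bullet> A) * real_cond_exp P ?F (Y i) \<omega>) \<in> borel_measurable P"
      by (rule borel_measurable_integrable[OF F.real_cond_exp_intg(1)[OF int fF Ym]])
    show "(\<lambda>\<omega>. mat_inner A0 (X i \<omega>) * mat_inner A (X i \<omega>)) \<in> borel_measurable P"
      by (rule borel_measurable_integrable[OF XX_integrable[OF i]])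
  qed
  finally show ?thesis .
qed

text \<open>Completing the square. Because the linear term has mean \<open>2 * ip A0 A\<close>, the objective is, up to a
  constant, the squared distance to \<open>A0\<close> plus the penalty, perturbed by the centred noise only.\<close>
lemma rank_penalized_objective_eq:
  "rank_penalized_objective P n X Y lam \<omega> A =
     (nrm (A - A0))\<^sup>2 - (nrm A0)\<^sup>2 - 2 * (noise_matrix P n X Y \<omega> \<bullet> A) + lam * real (rank A)"
proof -
  let ?EYX = "\<lambda>i. \<integral>\<omega>. Y i \<omega> *\<^sub>R X i \<omega> \<partial>P"
  have "((1 / real n) *\<^sub>R (\<Sum>i=1..n. Y i \<omega> *\<^sub>R X i \<omega>)) \<bullet> A - noise_matrix P n X Y \<omega> \<bullet> A
      = (1 / real n) * (\<Sum>i=1..n. ?EYX i \<bullet> A)"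
    by (simp add: noise_matrix_def inner_sum_left sum_subtractf inner_diff_left
        right_diff_distrib diff_divide_distrib)
  also have "\<dots> = ip A0 A"
    by (simp add: expectation_response L2_inner_def)
  finally have mean: "((1 / real n) *\<^sub>R (\<Sum>i=1..n. Y i \<omega> *\<^sub>R X i \<omega>)) \<bullet> A
      = noise_matrix P n X Y \<omega> \<bullet> A + ip A0 A" by simp
  then have "((2 / real n) *\<^sub>R (\<Sum>i=1..n. Y i \<omega> *\<^sub>R X i \<omega>)) \<bullet> A
      = 2 * (noise_matrix P n X Y \<omega> \<bullet> A) + 2 * ip A0 A"
    by simp
  then show ?thesis
    by (simp add: rank_penalized_objective_def mat_inner_eq_inner L2_norm_power2
        L2_inner_simps L2_inner_commute[of A A0])
qed

end

section \<open>The basic inequality\<close>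

locale rank_penalized_regression = trace_regression P n X Y A0
  for P :: "'a measure" and n and X :: "nat \<Rightarrow> 'a \<Rightarrow> real^'n^'m" and Y A0 +
  fixes Ahat :: "'a \<Rightarrow> real^'n^'m" and \<mu> \<rho> lam :: real
  assumes \<mu>_pos: "\<mu> > 0"
    and restricted: "\<And>A. (L2_norm P n X A)\<^sup>2 \<ge> inverse (\<mu>\<^sup>2) * (norm A)\<^sup>2"
    and noise_integrable: "integrable P (\<lambda>\<omega>. (noise_level P n X Y \<omega>)\<^sup>2)"
    and \<rho>_ge_1: "\<rho> \<ge> 1" and lam_pos: "lam > 0"
    and lam_large: "sqrt lam \<ge> 2 * \<rho> * \<mu> * sqrt (noise_sup P n X Y)"
    and estimator: "rank_penalized_estimator P n X Y lam Ahat"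
begin

abbreviation \<Delta> :: "'a \<Rightarrow> real" where "\<Delta> \<equiv> noise_level P n X Y"
abbreviation rk :: "'a \<Rightarrow> real" where "rk \<omega> \<equiv> real (rank (Ahat \<omega>))"
abbreviation err :: "'a \<Rightarrow> real" where "err \<omega> \<equiv> nrm (Ahat \<omega> - A0)"

text \<open>An upper bound for the rank of \<open>Ahat - A\<close>. It is capped at \<open>min m1 m2\<close> because the supremum that
  defines the noise functional ranges over weights bounded by that number. With one weight
  for both ranks, instead of one for each, they share a single maximum with \<open>1\<close> in the noise bound.\<close>
definition rank_weight :: "real^'n^'m \<Rightarrow> 'a \<Rightarrow> real" where
  "rank_weight A \<omega> = real (min (rank (Ahat \<omega>) + rank A) (min CARD('m) CARD('n)))"

definition scaled_noise :: "real^'n^'m \<Rightarrow> 'a \<Rightarrow> real" where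
  "scaled_noise A \<omega> = \<mu> * \<Delta> \<omega> * sqrt (rank_weight A \<omega>)"

lemma noise_level_nonneg: "0 \<le> \<Delta> \<omega>"
  by (simp add: noise_level_def largest_singular_value_eq_onorm onorm_pos_le
      matrix_vector_mul_bounded_linear)

lemma norm_le_L2_norm: "norm A \<le> \<mu> * nrm A"
proof (rule power2_le_imp_le)
  show "(norm A)\<^sup>2 \<le> (\<mu> * nrm A)\<^sup>2"
    using restricted[of A] \<mu>_pos by (simp add: power_mult_distrib field_simps)
qed (use \<mu>_pos in \<open>simp add: L2_norm_nonneg\<close>)

lemma noise_inner_le:
  "noise_matrix P n X Y \<omega> \<bullet> (Ahat \<omega> - A) \<le> scaled_noise A \<omega> * (err \<omega> + nrm (A - A0))"
proof -
  have "noise_matrix P n X Y \<omega> \<bullet> (Ahat \<omega> - A)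
      \<le> \<Delta> \<omega> * sqrt (rank (Ahat \<omega> - A)) * norm (Ahat \<omega> - A)"
    using inner_le_onorm_sqrt_rank[of "noise_matrix P n X Y \<omega>" "Ahat \<omega> - A"]
    by (simp add: noise_level_def largest_singular_value_eq_onorm)
  also have "\<dots> \<le> \<Delta> \<omega> * sqrt (rank_weight A \<omega>) * (\<mu> * (err \<omega> + nrm (A - A0)))"
  proof (intro mult_mono mult_nonneg_nonneg real_sqrt_le_mono)
    show "real (rank (Ahat \<omega> - A)) \<le> rank_weight A \<omega>"
      using rank_diff_le[of "Ahat \<omega>" A] rank_bound[of "Ahat \<omega> - A"]
      unfolding rank_weight_def by simp
    have "norm (Ahat \<omega> - A) \<le> \<mu> * nrm ((Ahat \<omega> - A0) - (A - A0))"
      using norm_le_L2_norm[of "Ahat \<omega> - A"] by simp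
    also have "\<dots> \<le> \<mu> * (err \<omega> + nrm (A - A0))"
      using \<mu>_pos L2_norm_triangle_sub[of "Ahat \<omega> - A0" "A - A0"] by (intro mult_left_mono) auto
    finally show "norm (Ahat \<omega> - A) \<le> \<mu> * (err \<omega> + nrm (A - A0))" .
  qed (simp_all add: noise_level_nonneg rank_weight_def)
  finally show ?thesis by (simp add: scaled_noise_def mult_ac)
qed

text \<open>The minimizer does at least as well as any competitor \<open>A\<close>. In the rewritten objective the noise
  enters only through its inner product with \<open>Ahat - A\<close>, which trace duality controls.\<close>
lemma basic_inequality:
  assumes "\<omega> \<in> space P"
  shows "(err \<omega>)\<^sup>2 + lam * rk \<omega>
    \<le> (nrm (A - A0))\<^sup>2 + 2 * (scaled_noise A \<omega> * (err \<omega> + nrm (A - A0))) + lam * real (rank A)"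
proof -
  have "rank_penalized_objective P n X Y lam \<omega> (Ahat \<omega>)
      \<le> rank_penalized_objective P n X Y lam \<omega> A"
    using estimator assms
    by (auto simp: rank_penalized_estimator_def is_arg_min_linorder)
  then show ?thesis
    using noise_inner_le[of \<omega> A]
    by (simp add: rank_penalized_objective_eq inner_diff_right)
qed

section \<open>The scaled noise in mean square\<close>

lemma rk_measurable [measurable]: "rk \<in> borel_measurable P"
  using estimator measurable_compose[OF _ borel_measurable_rank]
  by (auto simp: rank_penalized_estimator_def)

lemma rk_integrable: "integrable P rk"
proof (rule integrable_const_bound[where B = "real CARD('n)"])
  show "AE \<omega> in P. norm (rk \<omega>) \<le> real CARD('n)"
    using rank_bound[of "Ahat _"] by simp
qed simp

lemma err_measurable [measurable]: "err \<in> borel_measurable P"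
proof -
  have [measurable]: "Ahat \<in> borel_measurable P"
    using estimator by (simp add: rank_penalized_estimator_def)
  show ?thesis
    by (rule measurable_compose[OF _ borel_measurable_L2_norm]) measurable
qed

lemma noise_level_measurable [measurable]: "\<Delta> \<in> borel_measurable P"
proof -
  have "(\<lambda>\<omega>. sqrt ((\<Delta> \<omega>)\<^sup>2)) \<in> borel_measurable P"
    using borel_measurable_integrable[OF noise_integrable] by measurable
  then show ?thesis by (simp add: noise_level_nonneg)
qed

lemma rank_weight_eq:
  "rank_weight A \<omega> = min (rk \<omega> + real (rank A)) (real (min CARD('m) CARD('n)))"
  by (simp add: rank_weight_def of_nat_min)

lemma rank_weight_measurable [measurable]: "rank_weight A \<in> borel_measurable P"
  unfolding rank_weight_eq[abs_def] by measurable

lemma scaled_noise_measurable [measurable]: "scaled_noise A \<in> borel_measurable P"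
  unfolding scaled_noise_def[abs_def] by measurable

lemma noise_times_bounded:
  assumes "W \<in> bounded_rvs P r"
  shows "integrable P (\<lambda>\<omega>. (\<Delta> \<omega>)\<^sup>2 * W \<omega>)"
    and "0 \<le> (\<integral>\<omega>. (\<Delta> \<omega>)\<^sup>2 * W \<omega> \<partial>P)"
    and "(\<integral>\<omega>. (\<Delta> \<omega>)\<^sup>2 * W \<omega> \<partial>P) \<le> (\<integral>\<omega>. (\<Delta> \<omega>)\<^sup>2 * r \<partial>P)"
proof -
  have [measurable]: "W \<in> borel_measurable P"
    and W: "\<And>\<omega>. \<omega> \<in> space P \<Longrightarrow> 0 \<le> W \<omega> \<and> W \<omega> \<le> r"
    using assms by (auto simp: bounded_rvs_def)
  have int: "integrable P (\<lambda>\<omega>. (\<Delta> \<omega>)\<^sup>2 * r)"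
    using noise_integrable by simp
  show iW: "integrable P (\<lambda>\<omega>. (\<Delta> \<omega>)\<^sup>2 * W \<omega>)"
  proof (rule Bochner_Integration.integrable_bound[OF int])
    show "AE \<omega> in P. norm ((\<Delta> \<omega>)\<^sup>2 * W \<omega>) \<le> norm ((\<Delta> \<omega>)\<^sup>2 * r)"
    proof (rule AE_I2)
      fix \<omega> assume "\<omega> \<in> space P"
      with W have "0 \<le> W \<omega>" "W \<omega> \<le> r" by blast+
      then show "norm ((\<Delta> \<omega>)\<^sup>2 * W \<omega>) \<le> norm ((\<Delta> \<omega>)\<^sup>2 * r)"
        by (simp add: abs_mult mult_left_mono)
    qed
  qed simp
  show "0 \<le> (\<integral>\<omega>. (\<Delta> \<omega>)\<^sup>2 * W \<omega> \<partial>P)"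
    using W by (intro integral_nonneg_AE AE_I2) simp
  show "(\<integral>\<omega>. (\<Delta> \<omega>)\<^sup>2 * W \<omega> \<partial>P) \<le> (\<integral>\<omega>. (\<Delta> \<omega>)\<^sup>2 * r \<partial>P)"
    using iW int W by (intro integral_mono mult_left_mono) auto
qed

text \<open>The supremum is over a bounded set, as each of its elements is at most \<open>min m1 m2\<close> times the second
  moment of the noise level; so it dominates every admissible weight, in particular \<open>rank_weight A\<close>.\<close>
lemma noise_sup_upper:
  assumes W: "W \<in> bounded_rvs P (real (min CARD('m) CARD('n)))"
  shows "(\<integral>\<omega>. (\<Delta> \<omega>)\<^sup>2 * W \<omega> \<partial>P) \<le> noise_sup P n X Y * max (\<integral>\<omega>. W \<omega> \<partial>P) 1"
proof -
  let ?r = "real (min CARD('m) CARD('n))"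
  have "(\<integral>\<omega>. (\<Delta> \<omega>)\<^sup>2 * W \<omega> \<partial>P) / max (\<integral>\<omega>. W \<omega> \<partial>P) 1 \<le> noise_sup P n X Y"
    unfolding noise_sup_def
  proof (rule cSUP_upper[OF W])
    show "bdd_above ((\<lambda>W. (\<integral>\<omega>. (\<Delta> \<omega>)\<^sup>2 * W \<omega> \<partial>P) / max (\<integral>\<omega>. W \<omega> \<partial>P) 1) ` bounded_rvs P ?r)"
    proof (rule bdd_aboveI2)
      fix V assume V: "V \<in> bounded_rvs P ?r"
      have "(\<integral>\<omega>. (\<Delta> \<omega>)\<^sup>2 * V \<omega> \<partial>P) / max (\<integral>\<omega>. V \<omega> \<partial>P) 1 \<le> (\<integral>\<omega>. (\<Delta> \<omega>)\<^sup>2 * V \<omega> \<partial>P) / 1"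
        using noise_times_bounded(2)[OF V] by (intro divide_left_mono) auto
      also have "\<dots> \<le> (\<integral>\<omega>. (\<Delta> \<omega>)\<^sup>2 * ?r \<partial>P)"
        using noise_times_bounded(3)[OF V] by simp
      finally show "(\<integral>\<omega>. (\<Delta> \<omega>)\<^sup>2 * V \<omega> \<partial>P) / max (\<integral>\<omega>. V \<omega> \<partial>P) 1 \<le> (\<integral>\<omega>. (\<Delta> \<omega>)\<^sup>2 * ?r \<partial>P)" .
    qed
  qed
  then show ?thesis by (simp add: pos_divide_le_eq)
qed

lemma noise_sup_nonneg: "0 \<le> noise_sup P n X Y"
  using noise_sup_upper[of "\<lambda>_. 0"] by (simp add: bounded_rvs_def)

lemma lam_ge_noise_sup: "4 * \<rho>\<^sup>2 * \<mu>\<^sup>2 * noise_sup P n X Y \<le> lam"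
proof -
  have "(2 * \<rho> * \<mu> * sqrt (noise_sup P n X Y))\<^sup>2 \<le> (sqrt lam)\<^sup>2"
    using lam_large \<mu>_pos \<rho>_ge_1 noise_sup_nonneg by (intro power_mono) auto
  then show ?thesis
    using lam_pos noise_sup_nonneg by (simp add: power_mult_distrib)
qed

lemma scaled_noise_power2: "(scaled_noise A \<omega>)\<^sup>2 = \<mu>\<^sup>2 * ((\<Delta> \<omega>)\<^sup>2 * rank_weight A \<omega>)"
  by (simp add: scaled_noise_def power_mult_distrib rank_weight_def)

lemma rank_weight_bounded: "rank_weight A \<in> bounded_rvs P (real (min CARD('m) CARD('n)))"
  using rank_weight_measurable[of A] unfolding bounded_rvs_def
  by (simp add: rank_weight_eq)

lemma scaled_noise_power2_integrable: "integrable P (\<lambda>\<omega>. (scaled_noise A \<omega>)\<^sup>2)"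
  using noise_times_bounded(1)[OF rank_weight_bounded] by (simp add: scaled_noise_power2)

text \<open>The hypothesis on \<open>lam\<close> is made for this inequality: in mean square the noise costs no more than the
  fraction \<open>1 / (4 * \<rho>\<^sup>2)\<close> of the penalty on \<open>rank Ahat + rank A\<close>, apart from the floor at rank \<open>1\<close>.\<close>
lemma expectation_scaled_noise_power2:
  "4 * \<rho>\<^sup>2 * (\<integral>\<omega>. (scaled_noise A \<omega>)\<^sup>2 \<partial>P) \<le> lam * max ((\<integral>\<omega>. rk \<omega> \<partial>P) + real (rank A)) 1"
proof -
  have "(\<integral>\<omega>. rank_weight A \<omega> \<partial>P) \<le> (\<integral>\<omega>. rk \<omega> + real (rank A) \<partial>P)"
  proof (rule integral_mono)
    show "integrable P (rank_weight A)"
      by (rule integrable_const_bound[where B = "real (min CARD('m) CARD('n))"])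
         (simp_all add: rank_weight_def)
  qed (simp_all add: rk_integrable rank_weight_eq)
  then have EW: "max (\<integral>\<omega>. rank_weight A \<omega> \<partial>P) 1 \<le> max ((\<integral>\<omega>. rk \<omega> \<partial>P) + real (rank A)) 1"
    by (simp add: rk_integrable prob_space)
  have "4 * \<rho>\<^sup>2 * (\<integral>\<omega>. (scaled_noise A \<omega>)\<^sup>2 \<partial>P)
      = 4 * \<rho>\<^sup>2 * \<mu>\<^sup>2 * (\<integral>\<omega>. (\<Delta> \<omega>)\<^sup>2 * rank_weight A \<omega> \<partial>P)"
    by (simp add: scaled_noise_power2)
  also have "\<dots> \<le> 4 * \<rho>\<^sup>2 * \<mu>\<^sup>2 * (noise_sup P n X Y * max (\<integral>\<omega>. rank_weight A \<omega> \<partial>P) 1)"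
    by (intro mult_left_mono noise_sup_upper rank_weight_bounded) simp
  also have "\<dots> = (4 * \<rho>\<^sup>2 * \<mu>\<^sup>2 * noise_sup P n X Y) * max (\<integral>\<omega>. rank_weight A \<omega> \<partial>P) 1"
    by simp
  also have "\<dots> \<le> lam * max ((\<integral>\<omega>. rk \<omega> \<partial>P) + real (rank A)) 1"
    using lam_ge_noise_sup lam_pos EW by (intro mult_mono) auto
  finally show ?thesis .
qed

section \<open>Rank of the estimator\<close>

text \<open>Take \<open>A = A0\<close> as competitor. Young's inequality absorbs the prediction error and leaves the linear
  inequality \<open>c * e \<le> max (e + r) 1 + c * r\<close> for the expected rank \<open>e\<close>, where \<open>c = 4 * \<rho>\<^sup>2\<close> and
  \<open>r = rank A0\<close>. The maximum can be \<open>1\<close> without being \<open>e + r\<close> only if \<open>r = 0\<close>, by integrality of \<open>r\<close>.\<close>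
lemma expectation_rk_le:
  "(\<integral>\<omega>. rk \<omega> \<partial>P) \<le> max ((1 + 2 / (4 * \<rho>\<^sup>2 - 1)) * real (rank A0)) (1 / (4 * \<rho>\<^sup>2))"
proof -
  define e where "e = (\<integral>\<omega>. rk \<omega> \<partial>P)"
  define c where "c = 4 * \<rho>\<^sup>2"
  let ?r = "real (rank A0)"
  have c: "4 \<le> c" using \<rho>_ge_1 by (simp add: c_def one_le_power)
  have pointwise: "lam * rk \<omega> \<le> (scaled_noise A0 \<omega>)\<^sup>2 + lam * ?r" if "\<omega> \<in> space P" for \<omega>
  proof -
    have "nrm (A0 - A0) = 0"
      by (simp add: L2_norm_def bilinear_lzero[OF bilinear_L2_inner])
    then show ?thesis
      using basic_inequality[OF that, of A0] sum_squares_bound[of "scaled_noise A0 \<omega>" "err \<omega>"]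
      by simp
  qed
  have "(\<integral>\<omega>. lam * rk \<omega> \<partial>P) \<le> (\<integral>\<omega>. (scaled_noise A0 \<omega>)\<^sup>2 + lam * ?r \<partial>P)"
    by (intro integral_mono pointwise) (simp_all add: rk_integrable scaled_noise_power2_integrable)
  then have "lam * e \<le> (\<integral>\<omega>. (scaled_noise A0 \<omega>)\<^sup>2 \<partial>P) + lam * ?r"
    by (simp add: e_def scaled_noise_power2_integrable prob_space)
  then have "c * (lam * e) \<le> c * (\<integral>\<omega>. (scaled_noise A0 \<omega>)\<^sup>2 \<partial>P) + c * (lam * ?r)"
    using c by (simp flip: distrib_left)
  also have "\<dots> \<le> lam * max (e + ?r) 1 + c * (lam * ?r)"
    using expectation_scaled_noise_power2[of A0] by (simp add: e_def c_def)
  finally have "lam * (c * e) \<le> lam * (max (e + ?r) 1 + c * ?r)"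
    by (simp add: algebra_simps)
  then have main: "c * e \<le> max (e + ?r) 1 + c * ?r"
    using lam_pos by simp
  have "e \<le> max ((1 + 2 / (c - 1)) * ?r) (1 / c)"
  proof (cases "1 \<le> e + ?r")
    case True
    then have "(c - 1) * e \<le> (c + 1) * ?r" using main by (simp add: algebra_simps)
    then have "e \<le> (1 + 2 / (c - 1)) * ?r" using c by (simp add: field_simps)
    then show ?thesis by simp
  next
    case False
    moreover have "0 \<le> e" by (simp add: e_def)
    ultimately have "rank A0 = 0" by auto
    then have "e \<le> 1 / c" using main False c by (simp add: field_simps)
    then show ?thesis by simp
  qed
  then show ?thesis by (simp add: e_def c_def)
qed

section \<open>Prediction error\<close>

text \<open>Young's inequality with weight \<open>1 / (2 * \<rho>\<^sup>2)\<close>, applied to the error of the estimator and to that of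
  \<open>A\<close>: this weight makes the noise enter with the factor \<open>4 * \<rho>\<^sup>2\<close> that its mean square can afford.\<close>
lemma err_power2_le:
  assumes "\<omega> \<in> space P"
  shows "(1 - 1 / (2 * \<rho>\<^sup>2)) * (err \<omega>)\<^sup>2 + lam * rk \<omega>
    \<le> (1 + 1 / (2 * \<rho>\<^sup>2)) * (nrm (A - A0))\<^sup>2 + 4 * \<rho>\<^sup>2 * (scaled_noise A \<omega>)\<^sup>2 + lam * real (rank A)"
proof -
  have young: "2 * (scaled_noise A \<omega> * z) \<le> 2 * \<rho>\<^sup>2 * (scaled_noise A \<omega>)\<^sup>2 + z\<^sup>2 / (2 * \<rho>\<^sup>2)" for z
  proof -
    define c where "c = sqrt (2 * \<rho>\<^sup>2)"
    have c: "c > 0" "c\<^sup>2 = 2 * \<rho>\<^sup>2" using \<rho>_ge_1 by (auto simp: c_def)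
    \<comment> \<open>Scaling both factors by \<open>c\<close> puts the weight into \<open>2 * u * v \<le> u\<^sup>2 + v\<^sup>2\<close>.\<close>
    have "2 * (c * scaled_noise A \<omega>) * (z / c) \<le> (c * scaled_noise A \<omega>)\<^sup>2 + (z / c)\<^sup>2"
      by (rule sum_squares_bound)
    then show ?thesis using c(1) by (simp add: power_mult_distrib power_divide c(2))
  qed
  show ?thesis
    using basic_inequality[OF assms, of A] young[of "err \<omega>"] young[of "nrm (A - A0)"]
    by (simp add: algebra_simps)
qed

lemma half_inverse_square: "1 / (2 * \<rho>\<^sup>2) < 1"
proof -
  have "1 \<le> \<rho>\<^sup>2" using \<rho>_ge_1 by (simp add: one_le_power)
  then show ?thesis by (subst pos_divide_less_eq) linarith+
qed

lemma err_power2_integrable: "integrable P (\<lambda>\<omega>. (err \<omega>)\<^sup>2)"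
proof -
  define t where "t = 1 - 1 / (2 * \<rho>\<^sup>2)"
  let ?b = "\<lambda>\<omega>. (1 + 1 / (2 * \<rho>\<^sup>2)) * (nrm (A0 - A0))\<^sup>2 + 4 * \<rho>\<^sup>2 * (scaled_noise A0 \<omega>)\<^sup>2
      + lam * real (rank A0)"
  have t: "t > 0" using half_inverse_square by (simp add: t_def)
  have "integrable P (\<lambda>\<omega>. t * (err \<omega>)\<^sup>2)"
  proof (rule Bochner_Integration.integrable_bound)
    show "integrable P ?b" by (simp add: scaled_noise_power2_integrable)
    show "AE \<omega> in P. norm (t * (err \<omega>)\<^sup>2) \<le> norm (?b \<omega>)"
    proof (rule AE_I2)
      fix \<omega> assume "\<omega> \<in> space P"
      moreover have "0 \<le> lam * rk \<omega>" using lam_pos by simp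
      ultimately have "t * (err \<omega>)\<^sup>2 \<le> ?b \<omega>"
        using err_power2_le[of \<omega> A0] unfolding t_def by linarith
      then show "norm (t * (err \<omega>)\<^sup>2) \<le> norm (?b \<omega>)" using t by simp
    qed
  qed simp
  then show ?thesis using t by simp
qed

lemma err_integrable: "integrable P err"
  by (rule square_integrable_imp_integrable) (simp_all add: err_power2_integrable)

text \<open>The noise bound returns \<open>rank Ahat\<close> with exactly the coefficient \<open>lam\<close> that the penalty has on the
  other side, so the random rank cancels and only the rank of the competitor remains.\<close>
lemma expectation_err_power2_le:
  "(\<integral>\<omega>. (err \<omega>)\<^sup>2 \<partial>P)
    \<le> (1 + 2 / (2 * \<rho>\<^sup>2 - 1)) * (nrm (A - A0))\<^sup>2
       + 2 * lam * (1 + 1 / (2 * \<rho>\<^sup>2 - 1)) * max (real (rank A)) (1 / 2)"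
proof -
  define e where "e = (\<integral>\<omega>. rk \<omega> \<partial>P)"
  define s where "s = (\<integral>\<omega>. (scaled_noise A \<omega>)\<^sup>2 \<partial>P)"
  define x where "x = (\<integral>\<omega>. (err \<omega>)\<^sup>2 \<partial>P)"
  define d where "d = 2 * \<rho>\<^sup>2"
  define y where "y = (nrm (A - A0))\<^sup>2"
  define M where "M = max (real (rank A)) (1 / 2)"
  let ?r = "real (rank A)"
  have d: "2 \<le> d" using \<rho>_ge_1 by (simp add: d_def one_le_power)
  have "(\<integral>\<omega>. (1 - 1 / d) * (err \<omega>)\<^sup>2 + lam * rk \<omega> \<partial>P)
      \<le> (\<integral>\<omega>. (1 + 1 / d) * y + 4 * \<rho>\<^sup>2 * (scaled_noise A \<omega>)\<^sup>2 + lam * ?r \<partial>P)"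
    unfolding d_def y_def
    by (intro integral_mono err_power2_le)
       (simp_all add: rk_integrable scaled_noise_power2_integrable err_power2_integrable)
  then have "(1 - 1 / d) * x + lam * e \<le> (1 + 1 / d) * y + 4 * \<rho>\<^sup>2 * s + lam * ?r"
    by (simp add: rk_integrable scaled_noise_power2_integrable err_power2_integrable prob_space
        e_def s_def x_def)
  moreover have "4 * \<rho>\<^sup>2 * s \<le> lam * max (e + ?r) 1"
    using expectation_scaled_noise_power2[of A] by (simp add: e_def s_def)
  moreover have "lam * (max (e + ?r) 1 + ?r - e) \<le> lam * (2 * M)"
  proof -
    have "max (e + ?r) 1 + ?r - e \<le> 2 * M"
    \<comment> \<open>For a nonzero integer rank the floor \<open>1\<close> is inactive; for rank \<open>0\<close> it is the floor \<open>1 / 2\<close> of \<open>M\<close>.\<close>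
    proof (cases "rank A = 0")
      case True
      moreover have "0 \<le> e" by (simp add: e_def)
      ultimately show ?thesis by (simp add: M_def)
    next
      case False
      then have "1 \<le> ?r" by simp
      moreover have "0 \<le> e" by (simp add: e_def)
      ultimately show ?thesis by (simp add: M_def)
    qed
    then show ?thesis using lam_pos by simp
  qed
  ultimately have "(1 - 1 / d) * x \<le> (1 + 1 / d) * y + lam * (2 * M)"
    by (simp add: algebra_simps)
  then have "d * ((1 - 1 / d) * x) \<le> d * ((1 + 1 / d) * y + lam * (2 * M))"
    using d by (intro mult_left_mono) auto
  then have "(d - 1) * x \<le> (d + 1) * y + 2 * lam * d * M"
    using d by (simp add: algebra_simps)
  then have "x \<le> ((d + 1) * y + 2 * lam * d * M) / (d - 1)"
    using d by (simp add: pos_le_divide_eq mult.commute)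
  also have "\<dots> = (1 + 2 / (d - 1)) * y + 2 * lam * (1 + 1 / (d - 1)) * M"
  proof -
    have "1 + 2 / (d - 1) = (d + 1) / (d - 1)" "1 + 1 / (d - 1) = d / (d - 1)"
      using d by (simp_all add: field_simps)
    then show ?thesis
      by (simp only: add_divide_distrib[of "_ * _"] times_divide_eq_left times_divide_eq_right)
  qed
  finally show ?thesis by (simp add: x_def d_def y_def M_def)
qed

text \<open>The two roots depend on the expected rank \<open>e\<close> of the estimator and cannot be large at the same
  time. If \<open>e < r\<close>, concavity of the square root bounds \<open>sqrt (e + r) + sqrt (r - e)\<close> by
  \<open>2 * sqrt r\<close>; otherwise the second root vanishes, \<open>e + r \<le> 2 * e\<close>, and the bound on \<open>e\<close> in terms
  of \<open>r0\<close> applies. Maximizing each root separately would only give the constant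
  \<open>1 + sqrt (8 / 3) > 5 / 2\<close> when \<open>\<rho> = 1\<close>.\<close>
lemma oracle_constant_le:
  fixes e :: real and r r0 :: nat
  assumes "e \<ge> 0"
    and e_le: "e \<le> max ((1 + 2 / (4 * \<rho>\<^sup>2 - 1)) * real r0) (1 / (4 * \<rho>\<^sup>2))"
  shows "1 / \<rho> * sqrt (max (e + real r) 1) + sqrt (max (real r - e) 0)
    \<le> 2 * sqrt (max (real r) (max (real r0 / \<rho>\<^sup>2) (1 / (4 * \<rho>\<^sup>2))))"
proof -
  define k where "k = 1 / \<rho> * sqrt (max (e + real r) 1)"
  define q where "q = sqrt (max (real r - e) 0)"
  define G where "G = max (real r) (max (real r0 / \<rho>\<^sup>2) (1 / (4 * \<rho>\<^sup>2)))"
  have \<rho>2: "1 \<le> \<rho>\<^sup>2" using \<rho>_ge_1 by (simp add: one_le_power)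
  have G: "real r \<le> G" "real r0 / \<rho>\<^sup>2 \<le> G" "1 / (4 * \<rho>\<^sup>2) \<le> G" by (auto simp: G_def)
  have k2: "k\<^sup>2 = max (e + real r) 1 / \<rho>\<^sup>2"
    by (simp add: k_def power_mult_distrib power_divide)
  have "(k + q)\<^sup>2 \<le> 4 * G"
  proof (cases "e < real r")
    case True
    then have "r \<noteq> 0" using \<open>e \<ge> 0\<close> by auto
    then have r: "1 \<le> real r" by simp
    have "max (e + real r) 1 / \<rho>\<^sup>2 \<le> (e + real r) / 1"
      using \<rho>2 r \<open>e \<ge> 0\<close> by (intro frac_le) auto
    then have kq: "k\<^sup>2 + q\<^sup>2 \<le> 2 * real r"
      using True by (simp add: k2 q_def)
    have "(k + q)\<^sup>2 \<le> 2 * (k\<^sup>2 + q\<^sup>2)"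
      using sum_squares_bound[of k q] by (simp add: power2_sum)
    also have "\<dots> \<le> 4 * G" using kq G(1) by simp
    finally show ?thesis .
  next
    case False
    have "1 + 2 / (4 * \<rho>\<^sup>2 - 1) \<le> 1 + 2 / 3"
      using \<rho>2 by (intro add_left_mono divide_left_mono) auto
    then have "(1 + 2 / (4 * \<rho>\<^sup>2 - 1)) * real r0 \<le> (5 / 3) * real r0"
      by (intro mult_right_mono) auto
    with e_le have "2 * e \<le> max (4 * real r0) (2 / (4 * \<rho>\<^sup>2))" by (auto simp: max_def split: if_splits)
    moreover have "2 / (4 * \<rho>\<^sup>2) \<le> 1" using \<rho>2 by (subst pos_divide_le_eq) linarith+
    ultimately have "max (e + real r) 1 \<le> max (4 * real r0) 1" using False by auto
    then have "max (e + real r) 1 / \<rho>\<^sup>2 \<le> max (4 * real r0) 1 / \<rho>\<^sup>2"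
      by (rule divide_right_mono) simp
    also have "\<dots> \<le> 4 * G"
      using G(2,3) by (auto simp: max_def)
    finally have "k\<^sup>2 \<le> 4 * G" unfolding k2 .
    moreover have "q = 0" using False by (simp add: q_def)
    ultimately show ?thesis by simp
  qed
  then have "(k + q)\<^sup>2 \<le> (2 * sqrt G)\<^sup>2"
    using G(1) by (simp add: power_mult_distrib)
  moreover have "0 \<le> 2 * sqrt G" using G(1) by simp
  ultimately have "k + q \<le> 2 * sqrt G" by (rule power2_le_imp_le)
  then show ?thesis unfolding k_def q_def G_def .
qed

text \<open>To keep the coefficient \<open>1\<close> before the approximation error, Young's inequality is replaced by
  Cauchy--Schwarz: with \<open>x\<close> and \<open>s\<close> the root mean squares of the error and of the scaled noise and
  \<open>y\<close> the error of \<open>A\<close>, the basic inequality becomes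
  \<open>(x - s)\<^sup>2 \<le> (y + s)\<^sup>2 + lam * (rank A - e)\<close>, from which \<open>x\<close> is bounded by subadditivity of the
  square root.\<close>
lemma expectation_err_le:
  "(\<integral>\<omega>. err \<omega> \<partial>P) \<le> nrm (A - A0)
     + 5 / 2 * sqrt (lam * max (real (rank A)) (max (real (rank A0) / \<rho>\<^sup>2) (1 / (4 * \<rho>\<^sup>2))))"
proof -
  define e where "e = (\<integral>\<omega>. rk \<omega> \<partial>P)"
  define s where "s = sqrt (\<integral>\<omega>. (scaled_noise A \<omega>)\<^sup>2 \<partial>P)"
  define x where "x = sqrt (\<integral>\<omega>. (err \<omega>)\<^sup>2 \<partial>P)"
  define y where "y = nrm (A - A0)"
  define q where "q = sqrt (max (real (rank A) - e) 0)"
  define G where "G = max (real (rank A)) (max (real (rank A0) / \<rho>\<^sup>2) (1 / (4 * \<rho>\<^sup>2)))"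
  have nonneg: "0 \<le> e" "0 \<le> s" "0 \<le> x" "0 \<le> y" "0 \<le> q" "0 \<le> G"
    by (simp_all add: e_def s_def x_def y_def q_def L2_norm_nonneg G_def)
  have s2: "s\<^sup>2 = (\<integral>\<omega>. (scaled_noise A \<omega>)\<^sup>2 \<partial>P)" and x2: "x\<^sup>2 = (\<integral>\<omega>. (err \<omega>)\<^sup>2 \<partial>P)"
    by (simp_all add: s_def x_def)
  note ax_square_integrable = scaled_noise_measurable err_measurable
    scaled_noise_power2_integrable err_power2_integrable
  have ax_int: "integrable P (\<lambda>\<omega>. scaled_noise A \<omega> * err \<omega>)"
    by (rule integral_Cauchy_Schwarz(1)[OF ax_square_integrable])
  have a_int: "integrable P (scaled_noise A)"
    by (rule square_integrable_imp_integrable) (simp_all add: scaled_noise_power2_integrable)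
  have ax: "(\<integral>\<omega>. scaled_noise A \<omega> * err \<omega> \<partial>P) \<le> s * x"
    by (rule power2_le_imp_le)
       (use integral_Cauchy_Schwarz(2)[OF ax_square_integrable, of A] nonneg in \<open>simp_all add: power_mult_distrib s2 x2\<close>)
  have a: "(\<integral>\<omega>. scaled_noise A \<omega> \<partial>P) \<le> s"
    by (rule power2_le_imp_le)
       (use integral_Cauchy_Schwarz(2)[of "scaled_noise A" P "\<lambda>_. 1"] nonneg in \<open>simp_all add: scaled_noise_power2_integrable prob_space s2\<close>)
  have Ex: "(\<integral>\<omega>. err \<omega> \<partial>P) \<le> x"
    by (rule power2_le_imp_le)
       (use integral_Cauchy_Schwarz(2)[of err P "\<lambda>_. 1"] nonneg in \<open>simp_all add: err_power2_integrable prob_space x2\<close>)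
  have "(\<integral>\<omega>. (err \<omega>)\<^sup>2 + lam * rk \<omega> \<partial>P)
      \<le> (\<integral>\<omega>. y\<^sup>2 + 2 * (scaled_noise A \<omega> * err \<omega>) + 2 * y * scaled_noise A \<omega> + lam * real (rank A) \<partial>P)"
  proof (rule integral_mono)
    fix \<omega> assume "\<omega> \<in> space P"
    then show "(err \<omega>)\<^sup>2 + lam * rk \<omega>
      \<le> y\<^sup>2 + 2 * (scaled_noise A \<omega> * err \<omega>) + 2 * y * scaled_noise A \<omega> + lam * real (rank A)"
      using basic_inequality[of \<omega> A] by (simp add: y_def algebra_simps)
  qed (simp_all add: rk_integrable err_power2_integrable ax_int a_int)
  then have "x\<^sup>2 + lam * e \<le> y\<^sup>2 + 2 * (\<integral>\<omega>. scaled_noise A \<omega> * err \<omega> \<partial>P)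
      + 2 * y * (\<integral>\<omega>. scaled_noise A \<omega> \<partial>P) + lam * real (rank A)"
    by (simp add: rk_integrable err_power2_integrable ax_int a_int prob_space x2 e_def)
  also have "\<dots> \<le> y\<^sup>2 + 2 * (s * x) + 2 * y * s + lam * real (rank A)"
    using ax a nonneg lam_pos by (intro add_mono mult_left_mono) auto
  finally have "x\<^sup>2 \<le> y\<^sup>2 + 2 * (s * x) + 2 * y * s + lam * (real (rank A) - e)"
    by (simp add: algebra_simps)
  also have "\<dots> \<le> y\<^sup>2 + 2 * (s * x) + 2 * y * s + (sqrt lam * q)\<^sup>2"
    using lam_pos by (simp add: power_mult_distrib q_def)
  finally have "(x - s)\<^sup>2 \<le> (y + s)\<^sup>2 + (sqrt lam * q)\<^sup>2"
    by (simp add: power2_sum power2_diff algebra_simps)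
  also have "\<dots> \<le> (y + s + sqrt lam * q)\<^sup>2"
    using nonneg lam_pos by (simp add: power2_sum[of "y + s"])
  finally have "x - s \<le> y + s + sqrt lam * q"
    by (rule power2_le_imp_le) (use nonneg lam_pos in auto)
  then have x: "x \<le> y + (2 * s + sqrt lam * q)" by simp
  have s: "2 * s \<le> sqrt lam * (1 / \<rho> * sqrt (max (e + real (rank A)) 1))"
  proof (rule power2_le_imp_le)
    have "4 * \<rho>\<^sup>2 * s\<^sup>2 \<le> lam * max (e + real (rank A)) 1"
      unfolding s2 e_def by (rule expectation_scaled_noise_power2)
    then show "(2 * s)\<^sup>2 \<le> (sqrt lam * (1 / \<rho> * sqrt (max (e + real (rank A)) 1)))\<^sup>2"
      using \<rho>_ge_1 lam_pos by (simp add: power_mult_distrib power_divide field_simps)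
  qed (use \<rho>_ge_1 lam_pos in simp)
  have "2 * s + sqrt lam * q \<le> sqrt lam * (1 / \<rho> * sqrt (max (e + real (rank A)) 1) + q)"
    using s by (simp add: distrib_left)
  also have "\<dots> \<le> sqrt lam * (2 * sqrt G)"
    using oracle_constant_le[OF nonneg(1) expectation_rk_le[folded e_def], of "rank A"] lam_pos
    unfolding q_def G_def by (intro mult_left_mono) auto
  also have "\<dots> \<le> 5 / 2 * sqrt (lam * G)"
    using nonneg lam_pos by (simp add: real_sqrt_mult)
  finally show ?thesis using x Ex unfolding y_def G_def by linarith
qed

end

section \<open>The oracle inequalities\<close>

theorem theorem3:
  fixes P :: "'a measure" and n :: nat
    and X :: "nat \<Rightarrow> 'a \<Rightarrow> real^'n^'m" and Y :: "nat \<Rightarrow> 'a \<Rightarrow> real"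
    and A0 :: "real^'n^'m" and Ahat :: "'a \<Rightarrow> real^'n^'m"
    and \<mu> \<rho> lam :: real
  assumes "prob_space P" and "n \<ge> 1"
    and indep: "prob_space.indep_vars P (\<lambda>_. borel) (\<lambda>i \<omega>. (X i \<omega>, Y i \<omega>)) {1..n}"
    and Y_int: "\<And>i. i \<in> {1..n} \<Longrightarrow> integrable P (Y i)"
    and YX_int: "\<And>i. i \<in> {1..n} \<Longrightarrow> integrable P (\<lambda>\<omega>. Y i \<omega> *\<^sub>R X i \<omega>)"
    and XX_int: "\<And>i A B. i \<in> {1..n} \<Longrightarrow>
          integrable P (\<lambda>\<omega>. mat_inner A (X i \<omega>) * mat_inner B (X i \<omega>))"
    and model: "\<And>i. i \<in> {1..n} \<Longrightarrow>
          AE \<omega> in P. real_cond_exp P (vimage_algebra (space P) (X i) borel) (Y i) \<omega>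
                     = trace (transpose (X i \<omega>) ** A0)"
    and "\<mu> > 0"
    and restricted: "\<And>A. (L2_norm P n X A)\<^sup>2 \<ge> inverse (\<mu>\<^sup>2) * (norm A)\<^sup>2"
    and noise_int: "integrable P (\<lambda>\<omega>. (noise_level P n X Y \<omega>)\<^sup>2)"
    and "\<rho> \<ge> 1" and "lam > 0"
    and "sqrt lam \<ge> 2 * \<rho> * \<mu> * sqrt (noise_sup P n X Y)"
    and estimator: "rank_penalized_estimator P n X Y lam Ahat"
  shows "(integrable P (\<lambda>\<omega>. real (rank (Ahat \<omega>))) \<and>
          (\<integral>\<omega>. real (rank (Ahat \<omega>)) \<partial>P)
            \<le> max ((1 + 2 / (4 * \<rho>\<^sup>2 - 1)) * real (rank A0)) (1 / (4 * \<rho>\<^sup>2)))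
       \<and> (integrable P (\<lambda>\<omega>. L2_norm P n X (Ahat \<omega> - A0)) \<and>
          (\<integral>\<omega>. L2_norm P n X (Ahat \<omega> - A0) \<partial>P)
            \<le> (INF A. L2_norm P n X (A - A0)
                 + 5 / 2 * sqrt (lam * max (real (rank A))
                                        (max (real (rank A0) / \<rho>\<^sup>2) (1 / (4 * \<rho>\<^sup>2))))))
       \<and> (integrable P (\<lambda>\<omega>. (L2_norm P n X (Ahat \<omega> - A0))\<^sup>2) \<and>
          (\<integral>\<omega>. (L2_norm P n X (Ahat \<omega> - A0))\<^sup>2 \<partial>P)
            \<le> (INF A. (1 + 2 / (2 * \<rho>\<^sup>2 - 1)) * (L2_norm P n X (A - A0))\<^sup>2
                 + 2 * lam * (1 + 1 / (2 * \<rho>\<^sup>2 - 1)) * max (real (rank A)) (1 / 2)))"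
proof -
  interpret prob_space P by fact
  have "X i \<in> borel_measurable P" if "i \<in> {1..n}" for i
  proof -
    have "(\<lambda>\<omega>. (X i \<omega>, Y i \<omega>)) \<in> borel_measurable P"
      using indep that by (simp add: indep_vars_def)
    then have "(\<lambda>\<omega>. fst (X i \<omega>, Y i \<omega>)) \<in> borel_measurable P"
      by (rule measurable_compose) (intro borel_measurable_continuous_onI continuous_intros)
    then show ?thesis by simp
  qed
  then interpret rank_penalized_regression P n X Y A0 Ahat \<mu> \<rho> lam
    by unfold_locales (use assms in \<open>auto dest: borel_measurable_integrable\<close>)
  show ?thesis
    by (intro conjI cINF_greatest rk_integrable expectation_rk_le err_integrable expectation_err_le
        err_power2_integrable expectation_err_power2_le) simp_all
qed

end
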